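(* Let $m\in\mathbb{N}$ and $L,R,T,\lambda_1,\dots,\lambda_{m+1}\in\mathbb{R}_{>0}$. Consider the implicit robust exact differentiator $\mathcal{D}^{(m)}_T$ and its approximate numerical implementation $\hat{\mathcal{D}}^{(m)}_T$ with tolerance $R$ (both defined in the context), with identical initial conditions. Then, for every real sequence $(u_k)$, there exists a sequence $(\varepsilon_k)$ satisfying $|\varepsilon_k|\le RLT^{m+1}$ for all $k$ such that the outputs of the two differentiators satisfy $\hat{\mathcal{D}}^{(m)}_T[(u_k)]=\mathcal{D}^{(m)}_T[(u_k+\varepsilon_k)]$. Moreover, $\varepsilon_k=0$ holds for all $k\in\mathbb{N}$ where $\mathcal{D}^{(m)}_T$ (with input $(u_k+\varepsilon_k)$) is in discrete-time sliding mode or, equivalently, where $|b_k|\le\lambda_{m+1}LT^{m+1}$.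
   Context: Notation: $\mathbb{N}=\{1,2,\dots\}$. For $y,p\in\mathbb{R}$ with $p\neq0$, $\lfloor y\rceil^{p}=|y|^p\operatorname{sign}(y)$; $\lfloor y\rceil^0$ is the set-valued sign: $\lfloor y\rceil^0=\{\operatorname{sign}(y)\}$ for $y\ne0$ and $\lfloor 0\rceil^0=[-1,1]$. Sums and products of scalars and sets are taken elementwise. Constants: $c_{i,j}$ for $i,j\in\mathbb{N}$ are defined by $c_{i,j}=\frac{(j-1)c_{i,j-1}+i\,c_{i-1,j-1}}{j}$ with $c_{0,0}=1$ and $c_{0,j}=c_{i,0}=0$ for $i,j\neq0$. Ideal differentiator $\mathcal{D}^{(m)}_T$: it has state $(z_{1,k},\dots,z_{m+1,k})$ with given initial value at $k=1$, and maps an input sequence $(v_k)$ to the output sequences $(y_{1,k}),\dots,(y_{m,k})$, written $\mathcal{D}^{(m)}_T[(v_k)]$, via the implicit relations, for $k\ge1$, $$z_{i,k+1}=z_{i,k}+T\lambda_iL^{\frac{i}{m+1}}\lfloor v_k-z_{1,k+1}\rceil^{\frac{m-i+1}{m+1}}+Tz_{i+1,k+1}\quad(i=1,\dots,m),$$ $$z_{m+1,k+1}\in z_{m+1,k}+T\lambda_{m+1}L\lfloor v_k-z_{1,k+1}\rceil^0,$$ $$y_{i,k}=\sum_{j=i}^{m}T^{j-i}c_{i,j}z_{j+1,k+1}\quad(i=1,\dots,m).$$ For every initial value and input these relations have a unique solution. It is in discrete-time sliding mode at time index $k$ if the set on the right-hand side of the inclusion contains more than one element, i.e. if $z_{1,k+1}=v_k$.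 Numerical implementation $\hat{\mathcal{D}}^{(m)}_T$: it has state $(\hat z_{1,k},\dots,\hat z_{m+1,k})$ with given initial value at $k=1$. For input $(u_k)$, for each $k\ge1$, let $$b_k=u_k-\sum_{i=1}^{m+1}T^{i-1}\hat z_{i,k}.$$ If $|b_k|>\lambda_{m+1}LT^{m+1}$, let $\hat r_k\in\mathbb{R}_{>0}$ be any number satisfying $$\hat r_k^{m+1}+\sum_{i=1}^{m+1}\lambda_i\hat r_k^{m-i+1}-\frac{|b_k|}{LT^{m+1}}\in[-R,R].$$ Set $\hat\rho_k=0$ if $|b_k|\le\lambda_{m+1}LT^{m+1}$ and $\hat\rho_k=\hat r_k\operatorname{sign}(b_k)$ otherwise. The state update is $$\hat z_{m+1,k+1}=\begin{cases}\hat z_{m+1,k}+\frac{b_k}{T^m}&\text{if }|b_k|\le\lambda_{m+1}LT^{m+1},\\ \hat z_{m+1,k}+\lambda_{m+1}LT\operatorname{sign}(b_k)&\text{otherwise,}\end{cases}$$ $$\hat z_{i,k+1}=\hat z_{i,k}+T\hat z_{i+1,k+1}+\lambda_iLT^{m-i+2}\lfloor\hat\rho_k\rceil^{m-i+1}\quad\text{for }i=m,\dots,1,$$ and the outputs, written $\hat{\mathcal{D}}^{(m)}_T[(u_k)]$, are $\hat y_{i,k}=\sum_{j=i}^{m}T^{j-i}c_{i,j}\hat z_{j+1,k+1}$ for $i=1,\dots,m$. *)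

theory Defs
  imports Complex_Main
begin

text \<open>
  Sequences are indexed by \<open>k \<ge> 1\<close> and state components by \<open>i = 1, \<dots>, m + 1\<close>; the component
  with index \<open>i\<close> at time \<open>k\<close> is \<open>z i k\<close>. Values outside these ranges are irrelevant.
\<close>

text \<open>The signed power, used for exponents \<open>p \<noteq> 0\<close> only; the exponent 0 is set-valued.\<close>

definition spow :: "real \<Rightarrow> real \<Rightarrow> real" where
  "spow y p = \<bar>y\<bar> powr p * sgn y"

definition spow0 :: "real \<Rightarrow> real set" where
  "spow0 y = (if y = 0 then {-1..1} else {sgn y})"

fun dcoeff :: "nat \<Rightarrow> nat \<Rightarrow> real" where
  "dcoeff 0 0 = 1"
| "dcoeff 0 (Suc j) = 0"
| "dcoeff (Suc i) 0 = 0"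
| "dcoeff (Suc i) (Suc j) =
     ((real (Suc j) - 1) * dcoeff (Suc i) j + real (Suc i) * dcoeff i j) / real (Suc j)"

text \<open>The output map, shared by both differentiators.\<close>

definition diff_output :: "nat \<Rightarrow> real \<Rightarrow> (nat \<Rightarrow> nat \<Rightarrow> real) \<Rightarrow> nat \<Rightarrow> nat \<Rightarrow> real" where
  "diff_output m T z i k = (\<Sum>j=i..m. T ^ (j - i) * dcoeff i j * z (j + 1) (k + 1))"

text \<open>The right-hand side of the inclusion for the last state of the ideal differentiator.\<close>

definition ideal_rhs ::
  "nat \<Rightarrow> real \<Rightarrow> real \<Rightarrow> (nat \<Rightarrow> real) \<Rightarrow> (nat \<Rightarrow> real) \<Rightarrow> (nat \<Rightarrow> nat \<Rightarrow> real) \<Rightarrow> nat \<Rightarrow> real set"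
where
  "ideal_rhs m L T lam v z k =
     (\<lambda>s. z (m + 1) k + T * lam (m + 1) * L * s) ` spow0 (v k - z 1 (k + 1))"

text \<open>\<open>z\<close> is a state trajectory of the ideal differentiator with initial value \<open>z0\<close> and input \<open>v\<close>.\<close>

definition ideal_solution ::
  "nat \<Rightarrow> real \<Rightarrow> real \<Rightarrow> (nat \<Rightarrow> real) \<Rightarrow> (nat \<Rightarrow> real) \<Rightarrow> (nat \<Rightarrow> real) \<Rightarrow> (nat \<Rightarrow> nat \<Rightarrow> real) \<Rightarrow> bool"
where
  "ideal_solution m L T lam z0 v z \<longleftrightarrow>
     (\<forall>i\<in>{1..m+1}. z i 1 = z0 i) \<and>
     (\<forall>k\<ge>1.
        (\<forall>i\<in>{1..m}. z i (k + 1) =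
           z i k
           + T * lam i * L powr (real i / real (m + 1))
               * spow (v k - z 1 (k + 1)) (real (m - i + 1) / real (m + 1))
           + T * z (i + 1) (k + 1)) \<and>
        z (m + 1) (k + 1) \<in> ideal_rhs m L T lam v z k)"

definition sliding_mode ::
  "nat \<Rightarrow> real \<Rightarrow> real \<Rightarrow> (nat \<Rightarrow> real) \<Rightarrow> (nat \<Rightarrow> real) \<Rightarrow> (nat \<Rightarrow> nat \<Rightarrow> real) \<Rightarrow> nat \<Rightarrow> bool"
where
  "sliding_mode m L T lam v z k \<longleftrightarrow>
     (\<exists>x\<in>ideal_rhs m L T lam v z k. \<exists>y\<in>ideal_rhs m L T lam v z k. x \<noteq> y)"

definition num_b :: "nat \<Rightarrow> real \<Rightarrow> (nat \<Rightarrow> real) \<Rightarrow> (nat \<Rightarrow> nat \<Rightarrow> real) \<Rightarrow> nat \<Rightarrow> real" where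
  "num_b m T u z k = u k - (\<Sum>i=1..m+1. T ^ (i - 1) * z i k)"

definition num_rho ::
  "nat \<Rightarrow> real \<Rightarrow> real \<Rightarrow> (nat \<Rightarrow> real) \<Rightarrow> (nat \<Rightarrow> real) \<Rightarrow> (nat \<Rightarrow> real) \<Rightarrow> (nat \<Rightarrow> nat \<Rightarrow> real) \<Rightarrow> nat \<Rightarrow> real"
where
  "num_rho m L T lam u r z k =
     (if \<bar>num_b m T u z k\<bar> \<le> lam (m + 1) * L * T ^ (m + 1) then 0
      else r k * sgn (num_b m T u z k))"

text \<open>
  \<open>z\<close> is a state trajectory of the numerical implementation with tolerance \<open>R\<close>, initial value \<open>z0\<close>
  and input \<open>u\<close>, for the admissible choices \<open>r\<close> of the approximate roots. The values \<open>r k\<close> are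
  unconstrained where no root is computed. In the residual, the exponent is written \<open>m + 1 - i\<close>
  because \<open>i = m + 1\<close> occurs, where the truncated \<open>m - i + 1\<close> would be 1 rather than 0.
\<close>

definition num_solution ::
  "nat \<Rightarrow> real \<Rightarrow> real \<Rightarrow> real \<Rightarrow> (nat \<Rightarrow> real) \<Rightarrow> (nat \<Rightarrow> real) \<Rightarrow> (nat \<Rightarrow> real) \<Rightarrow> (nat \<Rightarrow> real)
     \<Rightarrow> (nat \<Rightarrow> nat \<Rightarrow> real) \<Rightarrow> bool"
where
  "num_solution m L R T lam z0 u r z \<longleftrightarrow>
     (\<forall>i\<in>{1..m+1}. z i 1 = z0 i) \<and>
     (\<forall>k\<ge>1.
        (\<bar>num_b m T u z k\<bar> > lam (m + 1) * L * T ^ (m + 1) \<longrightarrow>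
           r k > 0 \<and>
           r k ^ (m + 1) + (\<Sum>i=1..m+1. lam i * r k ^ (m + 1 - i))
             - \<bar>num_b m T u z k\<bar> / (L * T ^ (m + 1)) \<in> {-R..R}) \<and>
        z (m + 1) (k + 1) =
          (if \<bar>num_b m T u z k\<bar> \<le> lam (m + 1) * L * T ^ (m + 1)
           then z (m + 1) k + num_b m T u z k / T ^ m
           else z (m + 1) k + lam (m + 1) * L * T * sgn (num_b m T u z k)) \<and>
        (\<forall>i\<in>{1..m}. z i (k + 1) =
           z i k + T * z (i + 1) (k + 1)
           + lam i * L * T ^ (m - i + 2)
               * spow (num_rho m L T lam u r z k) (real (m - i + 1))))"

end

(*
  Take as perturbation the residual of the approximate root, scaled by L T^(m+1) and carrying the
  sign of b_k. Eliminating z_2, ..., z_(m+1) from one implicit step of the ideal differentiator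
  leaves a scalar inclusion for w = v_k - z_(1,k+1), and with this perturbation
  w = L T^(m+1) |rho_k|^(m+1) sign(b_k) solves it exactly. The map defining the inclusion is strictly
  increasing in w, so the step of the ideal differentiator has no other solution.
*)
theory Submission imports Defs begin

section \<open>Monotonicity of the signed powers, and back-substitution in a chain of implicit
  relations\<close>

lemma spow_zero [simp]: "spow 0 p = 0"
  by (simp add: spow_def)

lemma spow_mono:
  assumes "x \<le> y" "p > 0"
  shows "spow x p \<le> spow y p"
proof -
  consider "0 \<le> x" | "x < 0" "0 \<le> y" | "y < 0" by linarith
  then show ?thesis
  proof cases
    case 1
    then show ?thesis
      using assms by (auto simp: spow_def sgn_if powr_mono2)
  next
    case 2
    then have "spow x p \<le> 0" "0 \<le> spow y p" by (simp_all add: spow_def sgn_if)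
    then show ?thesis by linarith
  next
    case 3
    then show ?thesis
      using assms by (auto simp: spow_def sgn_if intro: powr_mono2)
  qed
qed

lemma spow0_bounds: "s \<in> spow0 x \<Longrightarrow> -1 \<le> s \<and> s \<le> 1"
  by (auto simp: spow0_def sgn_if split: if_splits)

text \<open>Strictness of \<open>x < y\<close> is essential: at \<open>x = y = 0\<close> both values
  are arbitrary in [-1, 1]. With it, either \<open>x\<close> is negative and \<open>s\<close> is the
  least possible value, or \<open>y\<close> is positive and \<open>t\<close> is the
  greatest.\<close>

lemma spow0_mono:
  assumes "x < y" "s \<in> spow0 x" "t \<in> spow0 y"
  shows "s \<le> t"
proof (cases "x < 0")
  case True
  then have "s = -1" using assms(2) by (simp add: spow0_def)
  then show ?thesis using spow0_bounds[OF assms(3)] by simp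
next
  case False
  then have "t = 1" using assms(1,3) by (simp add: spow0_def)
  then show ?thesis using spow0_bounds[OF assms(2)] by simp
qed

text \<open>Back-substitution from \<open>x 1\<close> upwards, each level costing a factor
  \<open>T\<close>. The correction \<open>g\<close> stays abstract so that the ideal and the
  numerical update can both be eliminated this way.\<close>

lemma implicit_chain_first:
  fixes T :: real
  assumes "\<forall>i\<in>{1..m}. x i = a i + g i + T * x (i + 1)"
  shows "x 1 = (\<Sum>i=1..m. T ^ (i - 1) * a i) + (\<Sum>i=1..m. T ^ (i - 1) * g i) + T ^ m * x (m + 1)"
  using assms
proof (induction m)
  case (Suc m)
  then have "x 1 = (\<Sum>i=1..m. T ^ (i - 1) * a i) + (\<Sum>i=1..m. T ^ (i - 1) * g i)
      + T ^ m * x (m + 1)" by simp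
  moreover have "x (m + 1) = a (m + 1) + g (m + 1) + T * x (Suc m + 1)"
    using Suc.prems by auto
  ultimately show ?case by (simp add: algebra_simps)
qed simp

section \<open>A single implicit step of the ideal differentiator\<close>

definition ideal_step ::
  "nat \<Rightarrow> real \<Rightarrow> real \<Rightarrow> (nat \<Rightarrow> real) \<Rightarrow> real \<Rightarrow> (nat \<Rightarrow> real) \<Rightarrow> (nat \<Rightarrow> real) \<Rightarrow> bool"
where
  "ideal_step m L T lam v a x \<longleftrightarrow>
     (\<forall>i\<in>{1..m}. x i = a i
        + T * lam i * L powr (real i / real (m + 1))
            * spow (v - x 1) (real (m - i + 1) / real (m + 1))
        + T * x (i + 1)) \<and>
     x (m + 1) \<in> (\<lambda>s. a (m + 1) + T * lam (m + 1) * L * s) ` spow0 (v - x 1)"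

lemma ideal_solution_iff_step:
  "ideal_solution m L T lam z0 v z \<longleftrightarrow>
     (\<forall>i\<in>{1..m+1}. z i 1 = z0 i) \<and>
     (\<forall>k\<ge>1. ideal_step m L T lam (v k) (\<lambda>i. z i k) (\<lambda>i. z i (k + 1)))"
  by (simp add: ideal_solution_def ideal_step_def ideal_rhs_def)

text \<open>Trajectories are compared on the indices \<open>1..m+1\<close> only, so the old states
  cannot be exchanged as whole functions in the induction over time.\<close>

lemma ideal_step_cong:
  assumes "\<And>i. i \<in> {1..m+1} \<Longrightarrow> a i = a' i"
  shows "ideal_step m L T lam v a x = ideal_step m L T lam v a' x"
  using assms by (simp add: ideal_step_def)

text \<open>Back-substitution leaves one equation for the error \<open>v - x 1\<close>; its left
  side depends only on the input and the old state. The selection \<open>s\<close> is exposed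
  because it also determines the last component.\<close>

lemma ideal_step_elim:
  assumes "ideal_step m L T lam v a x"
  obtains s where "s \<in> spow0 (v - x 1)" "x (m + 1) = a (m + 1) + T * lam (m + 1) * L * s"
    "v - (\<Sum>i=1..m+1. T ^ (i - 1) * a i) = (v - x 1)
       + (\<Sum>i=1..m. T ^ (i - 1) * (T * lam i * L powr (real i / real (m + 1))
            * spow (v - x 1) (real (m - i + 1) / real (m + 1))))
       + T ^ m * (T * lam (m + 1) * L * s)"
proof -
  obtain s where s: "s \<in> spow0 (v - x 1)" "x (m + 1) = a (m + 1) + T * lam (m + 1) * L * s"
    using assms by (auto simp: ideal_step_def)
  have "x 1 = (\<Sum>i=1..m. T ^ (i - 1) * a i)
      + (\<Sum>i=1..m. T ^ (i - 1) * (T * lam i * L powr (real i / real (m + 1))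
            * spow (v - x 1) (real (m - i + 1) / real (m + 1))))
      + T ^ m * x (m + 1)"
    by (rule implicit_chain_first) (use assms in \<open>unfold ideal_step_def, blast\<close>)
  moreover have "(\<Sum>i=1..m+1. T ^ (i - 1) * a i) = (\<Sum>i=1..m. T ^ (i - 1) * a i) + T ^ m * a (m + 1)"
    by simp
  moreover have "T ^ m * x (m + 1) = T ^ m * a (m + 1) + T ^ m * (T * lam (m + 1) * L * s)"
    by (simp only: s(2) distrib_left)
  ultimately show thesis
    by (intro that[OF s]) linarith
qed

text \<open>A smaller \<open>x 1\<close> means a larger error. In the scalar equation the identity
  term is strictly increasing, while the signed powers and the selection are nondecreasing with
  positive weights; two different errors cannot yield the same left side.\<close>

lemma ideal_step_first_le:
  assumes "L > 0" "T > 0" and lam: "\<forall>i\<in>{1..m+1}. lam i > 0"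
    and x: "ideal_step m L T lam v a x" and y: "ideal_step m L T lam v a y"
  shows "x 1 \<le> y 1"
proof (rule ccontr)
  assume "\<not> x 1 \<le> y 1"
  then have less: "v - x 1 < v - y 1" by simp
  define G where "G w = (\<Sum>i=1..m. T ^ (i - 1) * (T * lam i * L powr (real i / real (m + 1))
            * spow w (real (m - i + 1) / real (m + 1))))" for w
  obtain s where s: "s \<in> spow0 (v - x 1)"
    "x (m + 1) = a (m + 1) + T * lam (m + 1) * L * s"
    "v - (\<Sum>i=1..m+1. T ^ (i - 1) * a i) = (v - x 1) + G (v - x 1) + T ^ m * (T * lam (m + 1) * L * s)"
    by (rule ideal_step_elim[OF x, folded G_def])
  obtain t where t: "t \<in> spow0 (v - y 1)"
    "y (m + 1) = a (m + 1) + T * lam (m + 1) * L * t"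
    "v - (\<Sum>i=1..m+1. T ^ (i - 1) * a i) = (v - y 1) + G (v - y 1) + T ^ m * (T * lam (m + 1) * L * t)"
    by (rule ideal_step_elim[OF y, folded G_def])
  have "G (v - x 1) \<le> G (v - y 1)"
    unfolding G_def
    using assms(1,2) lam less
    by (intro sum_mono mult_left_mono spow_mono mult_nonneg_nonneg) (auto simp: less_imp_le)
  moreover have "T ^ m * (T * lam (m + 1) * L * s) \<le> T ^ m * (T * lam (m + 1) * L * t)"
    using assms(1,2) lam spow0_mono[OF less s(1) t(1)]
    by (intro mult_left_mono mult_nonneg_nonneg) (auto simp: less_imp_le)
  ultimately show False using s(3) t(3) less by linarith
qed

lemma ideal_step_unique:
  assumes "L > 0" "T > 0" "\<forall>i\<in>{1..m+1}. lam i > 0"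
    and x: "ideal_step m L T lam v a x" and y: "ideal_step m L T lam v a y"
    and "i \<in> {1..m+1}"
  shows "x i = y i"
proof -
  have first: "x 1 = y 1"
    using ideal_step_first_le[OF assms(1-3) x y] ideal_step_first_le[OF assms(1-3) y x] by simp
  have last: "x (m + 1) = y (m + 1)"
  proof (rule ideal_step_elim[OF x], rule ideal_step_elim[OF y])
    fix s t
    assume st: "x (m + 1) = a (m + 1) + T * lam (m + 1) * L * s"
      "y (m + 1) = a (m + 1) + T * lam (m + 1) * L * t"
      "v - (\<Sum>i=1..m+1. T ^ (i - 1) * a i) = (v - x 1)
         + (\<Sum>i=1..m. T ^ (i - 1) * (T * lam i * L powr (real i / real (m + 1))
              * spow (v - x 1) (real (m - i + 1) / real (m + 1))))
         + T ^ m * (T * lam (m + 1) * L * s)"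
      "v - (\<Sum>i=1..m+1. T ^ (i - 1) * a i) = (v - y 1)
         + (\<Sum>i=1..m. T ^ (i - 1) * (T * lam i * L powr (real i / real (m + 1))
              * spow (v - y 1) (real (m - i + 1) / real (m + 1))))
         + T ^ m * (T * lam (m + 1) * L * t)"
    \<comment> \<open>At zero error the set-valued sign does not fix \<open>s\<close> and
      \<open>t\<close>. The scalar equation does: all its other terms agree once the errors
      agree.\<close>
    have "T ^ m * (T * lam (m + 1) * L * s) = T ^ m * (T * lam (m + 1) * L * t)"
      using st(3,4) unfolding first by linarith
    then have "T * lam (m + 1) * L * s = T * lam (m + 1) * L * t"
      using \<open>T > 0\<close> by (metis mult_left_cancel power_not_zero less_irrefl)
    then show ?thesis using st(1,2) by simp
  qed
  \<comment> \<open>Component \<open>i\<close> refers to the new component \<open>i + 1\<close>, so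
    equality propagates downwards from \<open>m + 1\<close>.\<close>
  from assms(6) have "i \<le> m + 1" "1 \<le> i" by auto
  then show ?thesis
  proof (induction i rule: inc_induct)
    case base
    show ?case by (rule last)
  next
    case (step i)
    then have "i \<in> {1..m}" by auto
    from step have "x (i + 1) = y (i + 1)" by auto
    moreover have "x i = a i
        + T * lam i * L powr (real i / real (m + 1))
            * spow (v - y 1) (real (m - i + 1) / real (m + 1))
        + T * x (i + 1)"
      using x \<open>i \<in> {1..m}\<close> unfolding ideal_step_def first by blast
    moreover have "y i = a i
        + T * lam i * L powr (real i / real (m + 1))
            * spow (v - y 1) (real (m - i + 1) / real (m + 1))
        + T * y (i + 1)"
      using y \<open>i \<in> {1..m}\<close> unfolding ideal_step_def by blast
    ultimately show ?case by simp
  qed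
qed

section \<open>Uniqueness of ideal trajectories and the sliding-mode criterion\<close>

lemma ideal_solution_unique:
  assumes "L > 0" "T > 0" "\<forall>i\<in>{1..m+1}. lam i > 0"
    and z: "ideal_solution m L T lam z0 v z" and z': "ideal_solution m L T lam z0 v z'"
    and "k \<ge> 1"
  shows "\<forall>i\<in>{1..m+1}. z i k = z' i k"
  using \<open>k \<ge> 1\<close>
proof (induction k rule: dec_induct)
  case base
  then show ?case using z z' by (simp add: ideal_solution_iff_step)
next
  case (step k)
  have "ideal_step m L T lam (v k) (\<lambda>i. z i k) (\<lambda>i. z i (k + 1))"
    using z step.hyps by (simp add: ideal_solution_iff_step)
  moreover have "ideal_step m L T lam (v k) (\<lambda>i. z' i k) (\<lambda>i. z' i (k + 1))"
    using z' step.hyps by (simp add: ideal_solution_iff_step)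
  then have "ideal_step m L T lam (v k) (\<lambda>i. z i k) (\<lambda>i. z' i (k + 1))"
    using ideal_step_cong[of m "\<lambda>i. z i k" "\<lambda>i. z' i k"] step.IH by simp
  ultimately show ?case
    using ideal_step_unique[OF assms(1-3),
        of "v k" "\<lambda>i. z i k" "\<lambda>i. z i (k + 1)" "\<lambda>i. z' i (k + 1)"]
    unfolding Suc_eq_plus1 by blast
qed

text \<open>Away from zero error the right-hand side is a singleton. At zero error it is the image
  of [-1, 1] under an affine map of positive slope, which already separates 0 and 1.\<close>

lemma sliding_mode_iff:
  assumes "L > 0" "T > 0" "lam (m + 1) > 0"
  shows "sliding_mode m L T lam v z k \<longleftrightarrow> z 1 (k + 1) = v k"
proof
  assume "sliding_mode m L T lam v z k"
  then show "z 1 (k + 1) = v k"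
    by (auto simp: sliding_mode_def ideal_rhs_def spow0_def split: if_splits)
next
  assume "z 1 (k + 1) = v k"
  then have "ideal_rhs m L T lam v z k = (\<lambda>s. z (m + 1) k + T * lam (m + 1) * L * s) ` {-1..1}"
    by (simp add: ideal_rhs_def spow0_def)
  moreover have "z (m + 1) k + T * lam (m + 1) * L * 0 \<noteq> z (m + 1) k + T * lam (m + 1) * L * 1"
    using assms by simp
  moreover have "(0::real) \<in> {-1..1}" "(1::real) \<in> {-1..1}" by auto
  ultimately show "sliding_mode m L T lam v z k"
    unfolding sliding_mode_def by blast
qed

section \<open>The input perturbation and its bound\<close>

definition num_residual ::
  "nat \<Rightarrow> real \<Rightarrow> real \<Rightarrow> (nat \<Rightarrow> real) \<Rightarrow> (nat \<Rightarrow> real) \<Rightarrow> (nat \<Rightarrow> real) \<Rightarrow> (nat \<Rightarrow> nat \<Rightarrow> real) \<Rightarrow> nat \<Rightarrow> real"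
where
  "num_residual m L T lam u r z k =
     r k ^ (m + 1) + (\<Sum>i=1..m+1. lam i * r k ^ (m + 1 - i))
       - \<bar>num_b m T u z k\<bar> / (L * T ^ (m + 1))"

text \<open>Adding this to \<open>num_b\<close> changes its modulus to the value for which
  \<open>r k\<close> is an exact root, keeping the sign factor. Below the threshold no root is
  computed and \<open>r k\<close> is unconstrained, hence the separate case.\<close>

definition num_perturbation ::
  "nat \<Rightarrow> real \<Rightarrow> real \<Rightarrow> (nat \<Rightarrow> real) \<Rightarrow> (nat \<Rightarrow> real) \<Rightarrow> (nat \<Rightarrow> real) \<Rightarrow> (nat \<Rightarrow> nat \<Rightarrow> real) \<Rightarrow> nat \<Rightarrow> real"
where
  "num_perturbation m L T lam u r z k =
     (if \<bar>num_b m T u z k\<bar> \<le> lam (m + 1) * L * T ^ (m + 1) then 0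
      else L * T ^ (m + 1) * num_residual m L T lam u r z k * sgn (num_b m T u z k))"

lemma abs_num_perturbation_le:
  assumes "L > 0" "R > 0" "T > 0" "num_solution m L R T lam z0 u r z" "k \<ge> 1"
  shows "\<bar>num_perturbation m L T lam u r z k\<bar> \<le> R * L * T ^ (m + 1)"
proof (cases "\<bar>num_b m T u z k\<bar> \<le> lam (m + 1) * L * T ^ (m + 1)")
  case True
  then show ?thesis using assms(1-3) by (simp add: num_perturbation_def)
next
  case False
  then have "num_residual m L T lam u r z k \<in> {-R..R}"
    using assms(4,5) unfolding num_solution_def num_residual_def by force
  then have "\<bar>num_residual m L T lam u r z k\<bar> \<le> R" by auto
  moreover have "\<bar>sgn (num_b m T u z k)\<bar> \<le> 1" by (simp add: sgn_if)
  ultimately have "\<bar>num_residual m L T lam u r z k\<bar> * \<bar>sgn (num_b m T u z k)\<bar> \<le> R * 1"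
    using assms(2) by (intro mult_mono) auto
  then have "L * T ^ (m + 1) * (\<bar>num_residual m L T lam u r z k\<bar> * \<bar>sgn (num_b m T u z k)\<bar>)
      \<le> L * T ^ (m + 1) * (R * 1)"
    using assms(1,3) by (intro mult_left_mono) auto
  then show ?thesis
    using False assms(1,3) by (simp add: num_perturbation_def abs_mult mult_ac)
qed

section \<open>The first state and the error after a numerical step\<close>

lemma num_solution_first:
  assumes "num_solution m L R T lam z0 u r z" "k \<ge> 1"
  shows "z 1 (k + 1) = (\<Sum>i=1..m. T ^ (i - 1) * z i k)
    + L * T ^ (m + 1) * (\<Sum>i=1..m. lam i * spow (num_rho m L T lam u r z k) (real (m - i + 1)))
    + T ^ m * z (m + 1) (k + 1)"
proof -
  have "z 1 (k + 1) = (\<Sum>i=1..m. T ^ (i - 1) * z i k)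
    + (\<Sum>i=1..m. T ^ (i - 1) * (lam i * L * T ^ (m - i + 2)
         * spow (num_rho m L T lam u r z k) (real (m - i + 1))))
    + T ^ m * z (m + 1) (k + 1)"
  proof (rule implicit_chain_first, rule ballI)
    fix i assume "i \<in> {1..m}"
    then have "z i (k + 1) = z i k + T * z (i + 1) (k + 1)
        + lam i * L * T ^ (m - i + 2) * spow (num_rho m L T lam u r z k) (real (m - i + 1))"
      using assms unfolding num_solution_def by blast
    then show "z i (k + 1) = z i k
        + lam i * L * T ^ (m - i + 2) * spow (num_rho m L T lam u r z k) (real (m - i + 1))
        + T * z (i + 1) (k + 1)" by linarith
  qed
  \<comment> \<open>The elimination weight and the numerical gain always multiply to
    \<open>T ^ (m + 1)\<close>, so the common factor \<open>L * T ^ (m + 1)\<close> leaves the sum.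
    The range of \<open>i\<close> keeps the natural subtractions exact.\<close>
  moreover have "T ^ (i - 1) * (lam i * L * T ^ (m - i + 2) * c) = L * T ^ (m + 1) * (lam i * c)"
    if "i \<in> {1..m}" for i c
  proof -
    have "i - 1 + (m - i + 2) = m + 1" using that by auto
    then have "T ^ (i - 1) * T ^ (m - i + 2) = T ^ (m + 1)" by (metis power_add)
    then show ?thesis by (metis mult.assoc mult.commute)
  qed
  then have "(\<Sum>i=1..m. T ^ (i - 1) * (lam i * L * T ^ (m - i + 2)
         * spow (num_rho m L T lam u r z k) (real (m - i + 1))))
      = L * T ^ (m + 1) * (\<Sum>i=1..m. lam i * spow (num_rho m L T lam u r z k) (real (m - i + 1)))"
    unfolding sum_distrib_left by (intro sum.cong refl)
  ultimately show ?thesis by simp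
qed

text \<open>Here \<open>num_rho\<close> is 0, so only the last state is corrected. Its increment
  \<open>num_b / T ^ m\<close> reaches the first state with weight \<open>T ^ m\<close>, which
  cancels the whole prediction error in one step.\<close>

lemma num_solution_error_sliding:
  assumes "T > 0" and sol: "num_solution m L R T lam z0 u r z" "k \<ge> 1"
    and "\<bar>num_b m T u z k\<bar> \<le> lam (m + 1) * L * T ^ (m + 1)"
  shows "z 1 (k + 1) = u k"
proof -
  have "z (m + 1) (k + 1) = z (m + 1) k + num_b m T u z k / T ^ m"
    using sol assms(4) unfolding num_solution_def by presburger
  then have "T ^ m * z (m + 1) (k + 1) = T ^ m * z (m + 1) k + num_b m T u z k"
    using assms(1) by (simp add: distrib_left)
  then show ?thesis
    using num_solution_first[OF sol] assms(4) by (simp add: num_rho_def num_b_def)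
qed

lemma spow_num_rho:
  assumes "r k > 0" "\<not> \<bar>num_b m T u z k\<bar> \<le> lam (m + 1) * L * T ^ (m + 1)"
    and "L > 0" "T > 0" "lam (m + 1) > 0"
  shows "spow (num_rho m L T lam u r z k) (real n) = r k ^ n * sgn (num_b m T u z k)"
proof -
  have "0 < lam (m + 1) * L * T ^ (m + 1)" using assms(3-5) by simp
  then have "num_b m T u z k \<noteq> 0" using assms(2) by auto
  then show ?thesis
    using assms(1,2)
    by (simp add: spow_def num_rho_def abs_mult sgn_mult powr_realpow)
qed

text \<open>Both the perturbed input and the new first state are the old prediction plus a multiple
  of the sign of \<open>num_b\<close>. The multiples share all polynomial terms except the leading
  one, \<open>r k ^ (m + 1)\<close>, which only the input contains.\<close>

lemma num_solution_error_reaching: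
  assumes "L > 0" "T > 0" "lam (m + 1) > 0"
    and sol: "num_solution m L R T lam z0 u r z" "k \<ge> 1"
    and not: "\<not> \<bar>num_b m T u z k\<bar> \<le> lam (m + 1) * L * T ^ (m + 1)"
  shows "u k + num_perturbation m L T lam u r z k - z 1 (k + 1)
    = L * (T * r k) ^ (m + 1) * sgn (num_b m T u z k)"
proof -
  let ?b = "num_b m T u z k"
  have r: "r k > 0" using sol not unfolding num_solution_def by force
  have last: "z (m + 1) (k + 1) = z (m + 1) k + lam (m + 1) * L * T * sgn ?b"
    using sol not unfolding num_solution_def by presburger
  \<comment> \<open>The term with \<open>i = m + 1\<close> is left out: its constant
    \<open>lam (m + 1)\<close> enters through the update of the last state.\<close>
  define S where "S = (\<Sum>i=1..m. lam i * r k ^ (m + 1 - i))"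
  have "(\<Sum>i=1..m. lam i * spow (num_rho m L T lam u r z k) (real (m - i + 1))) = S * sgn ?b"
    unfolding S_def sum_distrib_right
    by (rule sum.cong)
      (simp_all add: spow_num_rho[where r = r and k = k and lam = lam and m = m,
          OF r not assms(1-3)] Suc_diff_le del: of_nat_Suc of_nat_add)
  then have first: "z 1 (k + 1) = (\<Sum>i=1..m. T ^ (i - 1) * z i k) + L * T ^ (m + 1) * (S * sgn ?b)
      + T ^ m * (z (m + 1) k + lam (m + 1) * L * T * sgn ?b)"
    using num_solution_first[OF sol] last by simp
  have "L * T ^ (m + 1) * num_residual m L T lam u r z k
      = L * T ^ (m + 1) * (r k ^ (m + 1) + S + lam (m + 1)) - \<bar>?b\<bar>"
    using assms(1,2) by (simp add: num_residual_def S_def field_simps)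
  then have "num_perturbation m L T lam u r z k
      = L * T ^ (m + 1) * (r k ^ (m + 1) + S + lam (m + 1)) * sgn ?b - ?b"
    using not by (simp add: num_perturbation_def left_diff_distrib abs_mult_sgn)
  moreover have "u k = ?b + (\<Sum>i=1..m. T ^ (i - 1) * z i k) + T ^ m * z (m + 1) k"
    by (simp add: num_b_def)
  ultimately show ?thesis
    unfolding first by (simp add: algebra_simps power_mult_distrib)
qed

text \<open>The two exponents add up to 1, so the fractional powers of \<open>L\<close> merge into
  \<open>L\<close>, and the root of \<open>q ^ (m + 1)\<close> is an integer power of
  \<open>q\<close>. This turns the ideal corrections into polynomial ones.\<close>

lemma spow_scaled_power:
  assumes "L > 0" "q > 0" "i \<in> {1..m}"
  shows "L powr (real i / real (m + 1))
      * spow (L * q ^ (m + 1) * sgn b) (real (m - i + 1) / real (m + 1))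
    = L * q ^ (m - i + 1) * sgn b"
proof (cases "b = 0")
  case False
  define p where "p = real (m - i + 1) / real (m + 1)"
  have sum: "real i / real (m + 1) + p = 1"
  proof -
    have "real i + real (m - i + 1) = real (m + 1)" using assms(3) by auto
    then show ?thesis unfolding p_def add_divide_distrib[symmetric] by simp
  qed
  have "(q ^ (m + 1)) powr p = q powr (real (m + 1) * p)"
    using assms(2) by (metis powr_powr powr_realpow)
  also have "real (m + 1) * p = real (m - i + 1)"
    by (simp add: p_def)
  finally have "(q ^ (m + 1)) powr p = q ^ (m - i + 1)"
    using assms(2) by (simp only: powr_realpow)
  then have "(q ^ Suc m) powr p = q ^ Suc (m - i)" by simp
  then have "spow (L * q ^ (m + 1) * sgn b) p = L powr p * q ^ (m - i + 1) * sgn b"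
    using assms(1,2) False
    by (simp add: spow_def abs_mult sgn_mult powr_mult del: power_Suc)
  moreover have "L powr (real i / real (m + 1)) * L powr p = L"
    using assms(1) by (simp only: powr_add[symmetric] sum) simp
  ultimately show ?thesis
    unfolding p_def[symmetric] by (simp only: mult.assoc[symmetric])
qed simp

section \<open>The numerical trajectory as a solution of the ideal relations\<close>

lemma num_solution_is_ideal:
  assumes "L > 0" "T > 0" "lam (m + 1) > 0"
    and sol: "num_solution m L R T lam z0 u r z"
  shows "ideal_solution m L T lam z0 (\<lambda>k. u k + num_perturbation m L T lam u r z k) z"
  unfolding ideal_solution_iff_step
proof (intro conjI allI impI)
  show "\<forall>i\<in>{1..m+1}. z i 1 = z0 i" using sol by (simp add: num_solution_def)
next
  fix k :: nat assume k: "k \<ge> 1"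
  let ?b = "num_b m T u z k" and ?v = "u k + num_perturbation m L T lam u r z k"
  have comp: "z i (k + 1) = z i k + T * z (i + 1) (k + 1)
      + lam i * L * T ^ (m - i + 2) * spow (num_rho m L T lam u r z k) (real (m - i + 1))"
    if "i \<in> {1..m}" for i
    using sol k that unfolding num_solution_def by blast
  show "ideal_step m L T lam ?v (\<lambda>i. z i k) (\<lambda>i. z i (k + 1))"
  proof (cases "\<bar>?b\<bar> \<le> lam (m + 1) * L * T ^ (m + 1)")
    case True
    have err: "?v - z 1 (k + 1) = 0"
      using num_solution_error_sliding[OF assms(2) sol k True] True
      by (simp add: num_perturbation_def)
    have "z (m + 1) (k + 1) = z (m + 1) k + ?b / T ^ m"
      using sol k True unfolding num_solution_def by presburger
    \<comment> \<open>The selection from the set-valued sign is \<open>num_b\<close> divided by the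
      threshold; the case assumption says exactly that it lies in [-1, 1].\<close>
    also have "\<dots> = z (m + 1) k + T * lam (m + 1) * L * (?b / (lam (m + 1) * L * T ^ (m + 1)))"
      using assms(1-3) by simp
    finally have last: "z (m + 1) (k + 1) = \<dots>" .
    have "\<bar>?b / (lam (m + 1) * L * T ^ (m + 1))\<bar> \<le> 1"
      using True assms(1-3) by (simp add: abs_mult divide_le_eq)
    then have "?b / (lam (m + 1) * L * T ^ (m + 1)) \<in> spow0 0"
      unfolding spow0_def by (simp only: abs_le_iff) auto
    moreover have "z i (k + 1) = z i k + T * z (i + 1) (k + 1)" if "i \<in> {1..m}" for i
      using comp[OF that] True by (simp add: num_rho_def)
    ultimately show ?thesis
      unfolding ideal_step_def err spow_zero mult_zero_right add_0_right using last by blast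
  next
    case False
    have r: "r k > 0" using sol k False unfolding num_solution_def by force
    note err = num_solution_error_reaching[OF assms(1-3) sol k False]
    have "0 < lam (m + 1) * L * T ^ (m + 1)" using assms(1-3) by simp
    then have "?b \<noteq> 0" using False by auto
    \<comment> \<open>The error is a positive multiple of \<open>sgn ?b\<close>, which is nonzero,
      so its set-valued sign is a singleton.\<close>
    then have "sgn ?b \<in> spow0 (L * (T * r k) ^ (m + 1) * sgn ?b)"
      using assms(1,2) r by (simp add: spow0_def sgn_mult)
    moreover have "z (m + 1) (k + 1) = z (m + 1) k + lam (m + 1) * L * T * sgn ?b"
      using sol k False unfolding num_solution_def by presburger
    then have "z (m + 1) (k + 1) = z (m + 1) k + T * lam (m + 1) * L * sgn ?b"
      by (simp only: mult_ac)
    moreover have "z i (k + 1) = z i k + T * lam i * L powr (real i / real (m + 1))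
          * spow (L * (T * r k) ^ (m + 1) * sgn ?b) (real (m - i + 1) / real (m + 1))
        + T * z (i + 1) (k + 1)" if i: "i \<in> {1..m}" for i
    proof -
      have "T * lam i * L powr (real i / real (m + 1))
          * spow (L * (T * r k) ^ (m + 1) * sgn ?b) (real (m - i + 1) / real (m + 1))
        = T * lam i * (L * (T * r k) ^ (m - i + 1) * sgn ?b)"
        unfolding mult.assoc[of "T * lam i"]
        using spow_scaled_power[OF assms(1) _ i, of "T * r k" ?b] assms(2) r by simp
      \<comment> \<open>The explicit step size \<open>T\<close> and the powers of \<open>T\<close>
        inside \<open>T * r k\<close> combine to the exponent \<open>m - i + 2\<close> of the
        numerical gain.\<close>
      also have "\<dots> = lam i * L * T ^ (m - i + 2) * (r k ^ (m - i + 1) * sgn ?b)"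
        by (simp add: power_mult_distrib)
      also have "r k ^ (m - i + 1) * sgn ?b = spow (num_rho m L T lam u r z k) (real (m - i + 1))"
        by (rule spow_num_rho[where r = r and k = k and lam = lam and m = m,
              OF r False assms(1-3), symmetric])
      finally show ?thesis using comp[OF i] by linarith
    qed
    ultimately show ?thesis
      unfolding ideal_step_def err by blast
  qed
qed

text \<open>Below the threshold the error is cancelled exactly. Above it the error is a product of
  nonzero factors, since \<open>r k\<close> is positive and \<open>num_b\<close> exceeds a positive
  bound in modulus.\<close>

lemma num_solution_error_eq_0_iff:
  assumes "L > 0" "T > 0" "lam (m + 1) > 0"
    and sol: "num_solution m L R T lam z0 u r z" "k \<ge> 1"
  shows "z 1 (k + 1) = u k + num_perturbation m L T lam u r z k \<longleftrightarrow>
    \<bar>num_b m T u z k\<bar> \<le> lam (m + 1) * L * T ^ (m + 1)"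
proof (cases "\<bar>num_b m T u z k\<bar> \<le> lam (m + 1) * L * T ^ (m + 1)")
  case True
  then show ?thesis
    using num_solution_error_sliding[OF assms(2) sol True] by (simp add: num_perturbation_def)
next
  case False
  have "0 < lam (m + 1) * L * T ^ (m + 1)" using assms(1-3) by simp
  then have "num_b m T u z k \<noteq> 0" using False by auto
  moreover have "r k > 0" using sol False unfolding num_solution_def by force
  ultimately have "L * (T * r k) ^ (m + 1) * sgn (num_b m T u z k) \<noteq> 0"
    using assms(1,2) by (simp add: sgn_eq_0_iff)
  then show ?thesis
    using num_solution_error_reaching[OF assms(1-3) sol False] False by auto
qed

theorem proposition3p3:
  fixes m :: nat and L R T :: real and lam z0 u r :: "nat \<Rightarrow> real"
    and zh :: "nat \<Rightarrow> nat \<Rightarrow> real"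
  assumes "m \<ge> 1" and "L > 0" and "R > 0" and "T > 0"
    and "\<forall>i\<in>{1..m+1}. lam i > 0"
    and "num_solution m L R T lam z0 u r zh"
  shows "\<exists>\<epsilon> :: nat \<Rightarrow> real.
    (\<forall>k\<ge>1. \<bar>\<epsilon> k\<bar> \<le> R * L * T ^ (m + 1)) \<and>
    (\<exists>z. ideal_solution m L T lam z0 (\<lambda>k. u k + \<epsilon> k) z) \<and>
    (\<forall>z. ideal_solution m L T lam z0 (\<lambda>k. u k + \<epsilon> k) z \<longrightarrow>
       (\<forall>k\<ge>1. \<forall>i\<in>{1..m}. diff_output m T zh i k = diff_output m T z i k) \<and>
       (\<forall>k\<ge>1. sliding_mode m L T lam (\<lambda>k. u k + \<epsilon> k) z k \<longleftrightarrow>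
          \<bar>num_b m T u zh k\<bar> \<le> lam (m + 1) * L * T ^ (m + 1)) \<and>
       (\<forall>k\<ge>1. sliding_mode m L T lam (\<lambda>k. u k + \<epsilon> k) z k \<longrightarrow> \<epsilon> k = 0))"
proof (intro exI[of _ "num_perturbation m L T lam u r zh"] conjI)
  let ?v = "\<lambda>k. u k + num_perturbation m L T lam u r zh k"
  note sol = assms(6)
  have lam: "lam (m + 1) > 0" using assms(5) by simp
  show "\<forall>k\<ge>1. \<bar>num_perturbation m L T lam u r zh k\<bar> \<le> R * L * T ^ (m + 1)"
    using abs_num_perturbation_le[OF assms(2-4) sol] by blast
  have ideal: "ideal_solution m L T lam z0 ?v zh"
    by (rule num_solution_is_ideal[OF assms(2,4) lam sol])
  then show "\<exists>z. ideal_solution m L T lam z0 ?v z" by blast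
  show "\<forall>z. ideal_solution m L T lam z0 ?v z \<longrightarrow>
       (\<forall>k\<ge>1. \<forall>i\<in>{1..m}. diff_output m T zh i k = diff_output m T z i k) \<and>
       (\<forall>k\<ge>1. sliding_mode m L T lam ?v z k \<longleftrightarrow>
          \<bar>num_b m T u zh k\<bar> \<le> lam (m + 1) * L * T ^ (m + 1)) \<and>
       (\<forall>k\<ge>1. sliding_mode m L T lam ?v z k \<longrightarrow> num_perturbation m L T lam u r zh k = 0)"
  proof (intro allI impI)
    fix z assume "ideal_solution m L T lam z0 ?v z"
    \<comment> \<open>Since \<open>zh\<close> is itself an ideal trajectory, uniqueness reduces
      every claim about an arbitrary \<open>z\<close> to one about \<open>zh\<close>.\<close>
    then have eq: "zh i k = z i k" if "k \<ge> 1" "i \<in> {1..m+1}" for i k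
      using ideal_solution_unique[OF assms(2,4,5) ideal] that by blast
    \<comment> \<open>The outputs read components \<open>2..m+1\<close> at time
      \<open>k + 1\<close>, which is at least 1 for every natural \<open>k\<close>.\<close>
    have "diff_output m T zh i k = diff_output m T z i k" if "i \<in> {1..m}" for i k
      unfolding diff_output_def using that by (intro sum.cong) (auto simp: eq)
    \<comment> \<open>The resulting threshold test is the one that guards
      \<open>num_perturbation\<close>, so the perturbation vanishes in sliding mode by
      definition.\<close>
    moreover have slide: "sliding_mode m L T lam ?v z k \<longleftrightarrow>
          \<bar>num_b m T u zh k\<bar> \<le> lam (m + 1) * L * T ^ (m + 1)" if "k \<ge> 1" for k
      using sliding_mode_iff[where v = ?v and z = z and lam = lam and m = m, OF assms(2,4) lam] eq[of "k + 1" 1]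
        num_solution_error_eq_0_iff[OF assms(2,4) lam sol that] by simp
    ultimately show "(\<forall>k\<ge>1. \<forall>i\<in>{1..m}. diff_output m T zh i k = diff_output m T z i k) \<and>
       (\<forall>k\<ge>1. sliding_mode m L T lam ?v z k \<longleftrightarrow>
          \<bar>num_b m T u zh k\<bar> \<le> lam (m + 1) * L * T ^ (m + 1)) \<and>
       (\<forall>k\<ge>1. sliding_mode m L T lam ?v z k \<longrightarrow> num_perturbation m L T lam u r zh k = 0)"
      by (simp add: num_perturbation_def)
  qed
qed

end
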